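(* Let $\theta\in(0,1)$ be irrational and $\rho\in[0,1)$ with $\rho-\theta=-m\theta+p$ for integers $m\ge1$ and $p$. When $m\ge2$, let $l\ge0$ be defined by $q_l<m\le q_{l+1}$; when $m=1$, set $l=0$. Let $(\beta_k)_{k\ge1}$ and $(\beta'_k)_{k\ge1}$ be the two digit sequences defined in the context, and let $(V_k)_{k\ge0}$ and $(V'_k)_{k\ge0}$ be defined by $V_{-1}=V'_{-1}=1$, $V_0=V'_0=0$, $V_1=0^{a_1-\beta_1-1}10^{\beta_1}$, $V'_1=0^{a_1-\beta'_1-1}10^{\beta'_1}$, and for $k\ge1$ $$V_{k+1}=V_k^{a_{k+1}-\beta_{k+1}}V_{k-1}V_k^{\beta_{k+1}},\qquad V'_{k+1}=V_k'^{\,a_{k+1}-\beta'_{k+1}}V'_{k-1}V_k'^{\,\beta'_{k+1}}.$$ If $l$ is odd, then $\mathbf{s}_{\theta,\rho}=\lim_{k\to\infty}V_k$ and $\mathbf{s}'_{\theta,\rho}=\lim_{k\to\infty}V'_k$. If $l$ is even, then $\mathbf{s}_{\theta,\rho}=\lim_{k\to\infty}V'_k$ and $\mathbf{s}'_{\theta,\rho}=\lim_{k\to\infty}V_k$. Moreover, with $t_k=\beta_1+\beta_2q_1+\cdots+\beta_kq_{k-1}$ and $t'_k=\beta'_1+\beta'_2q_1+\cdots+\beta'_kq_{k-1}$, letting $T_k,T'_k$ be the prefixes of $M_k$ of lengths $t_k,t'_k$ and $R_k,R'_k$ the suffixes of $M_k$ of lengths $q_k-t_k$, $q_k-t'_k$,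 we have $V_k=R_kT_k$, $M_k=T_kR_k$, $V'_k=R'_kT'_k$, $M_k=T'_kR'_k$ for $k\ge1$.
   Context: $\theta=[0;a_1,a_2,\dots]$ with convergent denominators $q_{-1}=0$, $q_0=1$, $q_k=a_kq_{k-1}+q_{k-2}$. $\mathbf{s}_{\theta,\rho}=s_1s_2\cdots$, $\mathbf{s}'_{\theta,\rho}=s'_1s'_2\cdots$ with $s_n=\lfloor n\theta+\rho\rfloor-\lfloor(n-1)\theta+\rho\rfloor$, $s'_n=\lceil n\theta+\rho\rceil-\lceil(n-1)\theta+\rho\rceil$. Words $M_0=0$, $M_1=0^{a_1-1}1$, $M_k=M_{k-1}^{a_k}M_{k-2}$. Ostrowski expansion of an integer $N\ge0$: $N=\sum_{j\ge1}d_jq_{j-1}$ with $0\le d_1\le a_1-1$, $0\le d_j\le a_j$, $d_j=0$ whenever $d_{j+1}=a_{j+1}$. Digit sequences: if $m=1$ (i.e. $\rho=0$), $\beta=(a_1-1,0,a_3,0,a_5,0,\dots)$ (i.e. $\beta_1=a_1-1$, $\beta_{2j}=0$, $\beta_{2j+1}=a_{2j+1}$) and $\beta'=(0,a_2,0,a_4,0,\dots)$ (i.e. $\beta'_{2j-1}=0$, $\beta'_{2j}=a_{2j}$). If $m\ge2$, let $q_{l+1}-m=\beta_1q_0+\cdots+\beta_{l+1}q_l$ be the Ostrowski expansion of the integer $q_{l+1}-m$ and set $\beta_{l+2j}=0$, $\beta_{l+2j+1}=a_{l+2j+1}$ for $j\ge1$; set $\beta'_i=\beta_i$ for $i\le l$,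 $\beta'_{l+1}=\beta_{l+1}+1$, $\beta'_{l+2}=a_{l+2}-1$, and $\beta'_{l+2j+1}=0$, $\beta'_{l+2j+2}=a_{l+2j+2}$ for $j\ge1$. *)

theory Defs
  imports Complex_Main "HOL-Library.Sublist"
begin

text \<open>
  Complete quotients and partial quotients of the regular continued fraction expansion
  \<open>x = [a\<^sub>0; a\<^sub>1, a\<^sub>2, \<dots>]\<close> of a non-negative irrational number; for \<open>0 < x < 1\<close> we have \<open>a\<^sub>0 = 0\<close>.
\<close>

primrec cf_complete :: "real \<Rightarrow> nat \<Rightarrow> real" where
  "cf_complete x 0 = x"
| "cf_complete x (Suc k) = 1 / frac (cf_complete x k)"

definition cf_coeff :: "real \<Rightarrow> nat \<Rightarrow> nat" where
  "cf_coeff x k = nat \<lfloor>cf_complete x k\<rfloor>"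

text \<open>Convergent denominators; \<open>q\<^sub>-\<^sub>1 = 0\<close> is not indexed, it only enters \<open>q\<^sub>1 = a\<^sub>1 q\<^sub>0 + q\<^sub>-\<^sub>1\<close>.\<close>

fun cf_denom :: "(nat \<Rightarrow> nat) \<Rightarrow> nat \<Rightarrow> nat" where
  "cf_denom a 0 = 1"
| "cf_denom a (Suc 0) = a 1 * cf_denom a 0 + 0"
| "cf_denom a (Suc (Suc k)) = a (Suc (Suc k)) * cf_denom a (Suc k) + cf_denom a k"

text \<open>The infinite words are \<open>s 1, s 2, \<dots>\<close>; the value at index 0 is irrelevant.\<close>

definition lower_word :: "real \<Rightarrow> real \<Rightarrow> nat \<Rightarrow> int" where
  "lower_word \<theta> \<rho> n = \<lfloor>real n * \<theta> + \<rho>\<rfloor> - \<lfloor>(real n - 1) * \<theta> + \<rho>\<rfloor>"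

definition upper_word :: "real \<Rightarrow> real \<Rightarrow> nat \<Rightarrow> int" where
  "upper_word \<theta> \<rho> n = \<lceil>real n * \<theta> + \<rho>\<rceil> - \<lceil>(real n - 1) * \<theta> + \<rho>\<rceil>"

abbreviation word_power :: "'a list \<Rightarrow> nat \<Rightarrow> 'a list" where
  "word_power w n \<equiv> concat (replicate n w)"

text \<open>
  Letterwise convergence of finite words to the infinite word \<open>s 1, s 2, \<dots>\<close>. The words need not be
  prefixes of each other.
\<close>

definition word_limit :: "(nat \<Rightarrow> 'a list) \<Rightarrow> (nat \<Rightarrow> 'a) \<Rightarrow> bool" where
  "word_limit W s \<longleftrightarrow>
     (\<forall>n\<ge>1. eventually (\<lambda>k. n \<le> length (W k) \<and> W k ! (n - 1) = s n) sequentially)"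

fun M_word :: "(nat \<Rightarrow> nat) \<Rightarrow> nat \<Rightarrow> int list" where
  "M_word a 0 = [0]"
| "M_word a (Suc 0) = replicate (a 1 - 1) 0 @ [1]"
| "M_word a (Suc (Suc k)) = word_power (M_word a (Suc k)) (a (Suc (Suc k))) @ M_word a k"

text \<open>
  \<open>V\<^sub>-\<^sub>1 = 1\<close> is not indexed: the recursion for \<open>V\<^sub>k\<^sub>+\<^sub>1\<close> with \<open>k \<ge> 1\<close> does not use it.
  Subtraction is only applied when \<open>b\<^sub>1 \<le> a\<^sub>1 - 1\<close> and \<open>b\<^sub>k \<le> a\<^sub>k\<close>.
\<close>

fun V_word :: "(nat \<Rightarrow> nat) \<Rightarrow> (nat \<Rightarrow> nat) \<Rightarrow> nat \<Rightarrow> int list" where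
  "V_word a b 0 = [0]"
| "V_word a b (Suc 0) = replicate (a 1 - b 1 - 1) 0 @ [1] @ replicate (b 1) 0"
| "V_word a b (Suc (Suc k)) =
     word_power (V_word a b (Suc k)) (a (Suc (Suc k)) - b (Suc (Suc k)))
     @ V_word a b k
     @ word_power (V_word a b (Suc k)) (b (Suc (Suc k)))"

text \<open>Digits are indexed from 1; \<open>d 0 = 0\<close> is a dummy value that makes the expansion unique.\<close>

definition is_ostrowski :: "(nat \<Rightarrow> nat) \<Rightarrow> nat \<Rightarrow> (nat \<Rightarrow> nat) \<Rightarrow> bool" where
  "is_ostrowski a N d \<longleftrightarrow>
     d 0 = 0 \<and> d 1 \<le> a 1 - 1 \<and> (\<forall>j\<ge>1. d j \<le> a j) \<and>
     (\<forall>j\<ge>1. d (j + 1) = a (j + 1) \<longrightarrow> d j = 0) \<and>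
     (\<exists>n. (\<forall>j>n. d j = 0) \<and> N = (\<Sum>j=1..n. d j * cf_denom a (j - 1)))"

definition ostrowski :: "(nat \<Rightarrow> nat) \<Rightarrow> nat \<Rightarrow> nat \<Rightarrow> nat" where
  "ostrowski a N = (THE d. is_ostrowski a N d)"

lemma cf_denom_pos:
  assumes "\<And>k. k \<ge> 1 \<Longrightarrow> a k \<ge> 1"
  shows "cf_denom a k \<ge> 1"
  using assms by (induction a k rule: cf_denom.induct) (auto simp: Suc_le_eq)

lemma cf_denom_ge:
  assumes "\<And>k. k \<ge> 1 \<Longrightarrow> a k \<ge> 1"
  shows "cf_denom a (Suc k) \<ge> k"
proof (induction k)
  case (Suc k)
  have "1 * cf_denom a (Suc k) \<le> a (Suc (Suc k)) * cf_denom a (Suc k)"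
    by (rule mult_right_mono) (use assms in auto)
  moreover have "cf_denom a (Suc (Suc k)) = a (Suc (Suc k)) * cf_denom a (Suc k) + cf_denom a k"
    by simp
  ultimately show ?case using Suc cf_denom_pos[of a k, OF assms] by linarith
qed simp

lemma ostrowski_sum_less:
  assumes a: "\<And>k. k \<ge> 1 \<Longrightarrow> a k \<ge> 1"
    and d: "d 1 \<le> a 1 - 1" "\<And>j. j \<ge> 1 \<Longrightarrow> d j \<le> a j"
      "\<And>j. j \<ge> 1 \<Longrightarrow> d (j + 1) = a (j + 1) \<Longrightarrow> d j = 0"
  shows "(\<Sum>j=1..n. d j * cf_denom a (j - 1)) < cf_denom a n"
proof (induction n rule: less_induct)
  case (less n)
  show ?case
  proof (cases n)
    case 0
    then show ?thesis by simp
  next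
    case (Suc k)
    note n = this
    have IH: "(\<Sum>j=1..i. d j * cf_denom a (j - 1)) < cf_denom a i" if "i \<le> k" for i
      using less[of i] that n by simp
    show ?thesis
    proof (cases k)
      case 0
      then show ?thesis using n d(1) a[of 1] by simp
    next
      case (Suc i)
      show ?thesis
      proof (cases "d n = a n")
        case True
        then have "d k = 0" using d(3)[of k] n Suc by simp
        then show ?thesis using IH[of i] True n Suc by simp
      next
        case False
        then have "d n + 1 \<le> a n" using d(2)[of n] n by simp
        then have "(d n + 1) * cf_denom a k \<le> a n * cf_denom a k"
          by (rule mult_right_mono) simp
        then show ?thesis using IH[of k] n Suc by simp
      qed
    qed
  qed
qed

lemma is_ostrowski_sum:
  assumes "is_ostrowski a N d" "\<forall>j>n. d j = 0"
  shows "N = (\<Sum>j=1..n. d j * cf_denom a (j - 1))"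
proof -
  obtain k where k: "\<forall>j>k. d j = 0" "N = (\<Sum>j=1..k. d j * cf_denom a (j - 1))"
    using assms(1) unfolding is_ostrowski_def by blast
  have "(\<Sum>j=1..k. d j * cf_denom a (j - 1)) = (\<Sum>j=1..max n k. d j * cf_denom a (j - 1))"
    by (rule sum.mono_neutral_left) (use k(1) in auto)
  also have "\<dots> = (\<Sum>j=1..n. d j * cf_denom a (j - 1))"
    by (rule sum.mono_neutral_right) (use assms(2) in auto)
  finally show ?thesis using k(2) by simp
qed

lemma ostrowski_digits_unique:
  assumes a: "\<And>k. k \<ge> 1 \<Longrightarrow> a k \<ge> 1"
    and d: "d 1 \<le> a 1 - 1" "\<And>j. j \<ge> 1 \<Longrightarrow> d j \<le> a j"
      "\<And>j. j \<ge> 1 \<Longrightarrow> d (j + 1) = a (j + 1) \<Longrightarrow> d j = 0"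
    and e: "e 1 \<le> a 1 - 1" "\<And>j. j \<ge> 1 \<Longrightarrow> e j \<le> a j"
      "\<And>j. j \<ge> 1 \<Longrightarrow> e (j + 1) = a (j + 1) \<Longrightarrow> e j = 0"
  shows "(\<Sum>j=1..n. d j * cf_denom a (j - 1)) = (\<Sum>j=1..n. e j * cf_denom a (j - 1))
    \<Longrightarrow> 1 \<le> j \<Longrightarrow> j \<le> n \<Longrightarrow> d j = e j"
proof (induction n)
  case (Suc n)
  let ?D = "\<Sum>j=1..n. d j * cf_denom a (j - 1)"
  let ?E = "\<Sum>j=1..n. e j * cf_denom a (j - 1)"
  have D: "?D < cf_denom a n" by (rule ostrowski_sum_less; fact a d)
  have E: "?E < cf_denom a n" by (rule ostrowski_sum_less; fact a e)
  have eq: "d (Suc n) * cf_denom a n + ?D = e (Suc n) * cf_denom a n + ?E"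
    using Suc.prems(1) by simp
  have "(d (Suc n) * cf_denom a n + ?D) div cf_denom a n = d (Suc n)"
    using D by simp
  moreover have "(e (Suc n) * cf_denom a n + ?E) div cf_denom a n = e (Suc n)"
    using E by simp
  ultimately have top: "d (Suc n) = e (Suc n)" using eq by simp
  with eq have "?D = ?E" by simp
  with Suc.IH Suc.prems(2,3) top show ?case by (cases "j = Suc n") simp_all
qed simp

lemma ostrowski_exists:
  assumes a: "\<And>k. k \<ge> 1 \<Longrightarrow> a k \<ge> 1"
  shows "N < cf_denom a n \<Longrightarrow> \<exists>d. d 0 = 0 \<and> d 1 \<le> a 1 - 1 \<and> (\<forall>j\<ge>1. d j \<le> a j) \<and>
     (\<forall>j\<ge>1. d (j + 1) = a (j + 1) \<longrightarrow> d j = 0) \<and>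
     (\<forall>j>n. d j = 0) \<and> N = (\<Sum>j=1..n. d j * cf_denom a (j - 1))"
proof (induction n arbitrary: N)
  case 0
  show ?case by (rule exI[of _ "\<lambda>_. 0"]) (use 0 in auto)
next
  case (Suc n)
  define c where "c = N div cf_denom a n"
  define r where "r = N mod cf_denom a n"
  have pos: "cf_denom a n > 0" using cf_denom_pos[of a n, OF a] by simp
  have N: "N = c * cf_denom a n + r" unfolding c_def r_def by (rule div_mult_mod_eq[symmetric])
  have "r < cf_denom a n" unfolding r_def using pos by simp
  from Suc.IH[OF this] obtain d where d: "d 0 = 0" "d 1 \<le> a 1 - 1" "\<forall>j\<ge>1. d j \<le> a j"
     "\<forall>j\<ge>1. d (j + 1) = a (j + 1) \<longrightarrow> d j = 0"
     "\<forall>j>n. d j = 0" "r = (\<Sum>j=1..n. d j * cf_denom a (j - 1))" by blast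
  have c_le: "c \<le> a (Suc n) \<and> (n = 0 \<longrightarrow> c \<le> a 1 - 1) \<and> (n \<ge> 1 \<longrightarrow> c = a (Suc n) \<longrightarrow> d n = 0)"
  proof (cases n)
    case 0
    then show ?thesis using N Suc.prems a[of 1] by auto
  next
    case (Suc k)
    have lt: "c * cf_denom a n + r < a (Suc n) * cf_denom a n + cf_denom a k"
      using N Suc.prems \<open>n = Suc k\<close> by simp
    have kn: "cf_denom a k \<le> cf_denom a n"
    proof (cases k)
      case 0
      then show ?thesis using Suc a[of 1] by simp
    next
      case (Suc i)
      have "1 * cf_denom a k \<le> a n * cf_denom a k"
        by (rule mult_right_mono) (use a \<open>n = Suc k\<close> in auto)
      moreover have "cf_denom a n = a n * cf_denom a k + cf_denom a i"
        using Suc \<open>n = Suc k\<close> by simp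
      ultimately show ?thesis by linarith
    qed
    have "c * cf_denom a n < (a (Suc n) + 1) * cf_denom a n"
      using lt kn by (simp add: algebra_simps)
    then have "c < a (Suc n) + 1" by (metis mult_less_cancel2)
    moreover have "d n = 0" if "c = a (Suc n)"
    proof (rule ccontr)
      assume "d n \<noteq> 0"
      then have "1 * cf_denom a (n - 1) \<le> d n * cf_denom a (n - 1)"
        by (intro mult_right_mono) auto
      also have "\<dots> \<le> r" unfolding d(6)
        by (rule member_le_sum) (use Suc in auto)
      finally have "cf_denom a k \<le> r" using Suc by simp
      with lt that show False by simp
    qed
    ultimately show ?thesis using Suc by simp
  qed
  have sum: "(\<Sum>j=1..n. (d(Suc n := c)) j * cf_denom a (j - 1)) = r"
    unfolding d(6) by (rule sum.cong) auto
  have a': "a (Suc j) \<noteq> 0" for j using a[of "Suc j"] by simp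
  show ?case
  proof (rule exI[of _ "d(Suc n := c)"], intro conjI allI impI)
    show "N = (\<Sum>j=1..Suc n. (d(Suc n := c)) j * cf_denom a (j - 1))"
      using N sum by simp
    fix j :: nat
    assume j: "1 \<le> j" and eq: "(d(Suc n := c)) (j + 1) = a (j + 1)"
    show "(d(Suc n := c)) j = 0"
    proof (cases "j \<ge> Suc n")
      case True
      then show ?thesis using eq d(5)[rule_format, of "j + 1"] a'[of j] by simp
    next
      case False
      then show ?thesis using eq d(4)[rule_format, of j] c_le j by (cases "j = n") simp_all
    qed
  next
    fix j :: nat assume "1 \<le> j"
    then show "(d(Suc n := c)) j \<le> a j" using d(3) c_le by simp
  next
    show "(d(Suc n := c)) 1 \<le> a 1 - 1" using d(2) c_le by simp
  qed (use d(1,5) in simp_all)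
qed

text \<open>So the definite description defining \<open>ostrowski\<close> is meaningful.\<close>

lemma ex1_is_ostrowski:
  assumes a: "\<And>k. k \<ge> 1 \<Longrightarrow> a k \<ge> 1"
  shows "\<exists>!d. is_ostrowski a N d"
proof (rule ex_ex1I)
  have "N < cf_denom a (Suc (Suc N))" using cf_denom_ge[of a "Suc N", OF a] by simp
  from ostrowski_exists[OF a this] show "\<exists>d. is_ostrowski a N d"
    unfolding is_ostrowski_def by blast
next
  fix d e assume d: "is_ostrowski a N d" and e: "is_ostrowski a N e"
  obtain k where k: "\<forall>j>k. d j = 0" using d unfolding is_ostrowski_def by blast
  obtain i where i: "\<forall>j>i. e j = 0" using e unfolding is_ostrowski_def by blast
  define n where "n = max k i"
  have z: "\<forall>j>n. d j = 0" "\<forall>j>n. e j = 0" using k i by (auto simp: n_def)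
  have eq: "(\<Sum>j=1..n. d j * cf_denom a (j - 1)) = (\<Sum>j=1..n. e j * cf_denom a (j - 1))"
    using is_ostrowski_sum[OF d z(1)] is_ostrowski_sum[OF e z(2)] by simp
  have D: "d 0 = 0" "d 1 \<le> a 1 - 1" "\<And>j. j \<ge> 1 \<Longrightarrow> d j \<le> a j"
      "\<And>j. j \<ge> 1 \<Longrightarrow> d (j + 1) = a (j + 1) \<Longrightarrow> d j = 0"
    using d unfolding is_ostrowski_def by blast+
  have E: "e 0 = 0" "e 1 \<le> a 1 - 1" "\<And>j. j \<ge> 1 \<Longrightarrow> e j \<le> a j"
      "\<And>j. j \<ge> 1 \<Longrightarrow> e (j + 1) = a (j + 1) \<Longrightarrow> e j = 0"
    using e unfolding is_ostrowski_def by blast+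
  show "d = e"
  proof
    fix j
    consider "j = 0" | "1 \<le> j" "j \<le> n" | "j > n" by linarith
    then show "d j = e j"
    proof cases
      case 2
      show ?thesis
        by (rule ostrowski_digits_unique[where a = a and n = n]; fact a D E eq 2)
    qed (simp_all add: D(1) E(1) z)
  qed
qed

lemma cf_coeff_pos:
  assumes "x \<notin> \<rat>" "k \<ge> 1"
  shows "cf_coeff x k \<ge> 1"
proof -
  have irr: "cf_complete x k \<notin> \<rat>" for k
  proof (induction k)
    case (Suc k)
    have "frac (cf_complete x k) \<notin> \<rat>"
    proof
      assume "frac (cf_complete x k) \<in> \<rat>"
      then have "frac (cf_complete x k) + of_int \<lfloor>cf_complete x k\<rfloor> \<in> \<rat>" by simp
      with Suc show False by (simp add: frac_def)
    qed
    moreover have "inverse (cf_complete x (Suc k)) = frac (cf_complete x k)" by simp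
    ultimately show ?case using Rats_inverse by metis
  qed (use assms in simp)
  obtain i where k: "k = Suc i" using assms(2) by (cases k) auto
  have "frac (cf_complete x i) \<noteq> 0"
    using irr[of i] by (metis frac_eq_0_iff Ints_subset_Rats subsetD)
  then have "0 < frac (cf_complete x i)" by (simp add: order_le_neq_trans)
  then have "1 \<le> cf_complete x k"
    using frac_lt_1[of "cf_complete x i"] by (simp add: k)
  then show ?thesis by (simp add: cf_coeff_def le_nat_iff)
qed

text \<open>
  The digit sequences, indexed from 1. The case \<open>m = 1\<close> is \<open>\<rho> = 0\<close>; for \<open>m \<ge> 2\<close> they are used
  with \<open>q\<^sub>l < m \<le> q\<^sub>l\<^sub>+\<^sub>1\<close>, so that the Ostrowski expansion of \<open>q\<^sub>l\<^sub>+\<^sub>1 - m\<close> has no digit beyond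
  index \<open>l + 1\<close>.
\<close>

definition digits :: "(nat \<Rightarrow> nat) \<Rightarrow> nat \<Rightarrow> nat \<Rightarrow> nat \<Rightarrow> nat" where
  "digits a m l i =
     (if m = 1 then (if i = 1 then a 1 - 1 else if even i then 0 else a i)
      else if i \<le> l + 1 then ostrowski a (cf_denom a (l + 1) - m) i
      else if even (i - l) then 0 else a i)"

definition digits' :: "(nat \<Rightarrow> nat) \<Rightarrow> nat \<Rightarrow> nat \<Rightarrow> nat \<Rightarrow> nat" where
  "digits' a m l i =
     (if m = 1 then (if even i then a i else 0)
      else if i \<le> l then digits a m l i
      else if i = l + 1 then digits a m l i + 1
      else if i = l + 2 then a i - 1
      else if even (i - l) then a i else 0)"

definition digit_sum :: "(nat \<Rightarrow> nat) \<Rightarrow> (nat \<Rightarrow> nat) \<Rightarrow> nat \<Rightarrow> nat" where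
  "digit_sum a b k = (\<Sum>j=1..k. b j * cf_denom a (j - 1))"

end

theory Submission
  imports Defs
begin

text \<open>
  For any admissible digits, \<open>V\<^sub>k\<close> is the rotation of \<open>M\<^sub>k\<close> by \<open>t\<^sub>k\<close>. The letters of \<open>M\<^sub>k\<close> are
  \<open>\<lfloor>(i+1)\<theta>\<rfloor> - \<lfloor>i\<theta>\<rfloor>\<close> for \<open>1 \<le> i \<le> q\<^sub>k\<close>, because by the best approximation law a translation by
  \<open>q\<^sub>k \<theta> - p\<^sub>k\<close> moves no point \<open>i\<theta>\<close> with \<open>0 < i < q\<^sub>k\<^sub>+\<^sub>1\<close> across an integer. For both digit sequences
  \<open>t\<^sub>k = q\<^sub>k - m\<close> for every large \<open>k\<close> of one parity, and \<open>V\<^sub>k\<close> is then a prefix of \<open>V\<^sub>k\<^sub>+\<^sub>1\<close>. Such a \<open>V\<^sub>k\<close>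
  consists of the last \<open>m\<close> letters of \<open>M\<^sub>k\<close> followed by a prefix of \<open>M\<^sub>k\<close>, which is the coding of the
  orbit started at \<open>(1 - m)\<theta>\<close>. When this orbit passes through 0, the sign of \<open>q\<^sub>k \<theta> - p\<^sub>k\<close>, i.e. the
  parity of \<open>k\<close>, decides between floor and ceiling.
\<close>

section \<open>Conjugates of the words \<open>M\<^sub>k\<close>\<close>

text \<open>The digit conditions of \<open>is_ostrowski\<close> without finite support, which the
  two infinite digit sequences do not have.\<close>

definition admissible_digits :: "(nat \<Rightarrow> nat) \<Rightarrow> (nat \<Rightarrow> nat) \<Rightarrow> bool" where
  "admissible_digits a d \<longleftrightarrow>
     d 1 \<le> a 1 - 1 \<and> (\<forall>j\<ge>1. d j \<le> a j) \<and> (\<forall>j\<ge>1. d (Suc j) = a (Suc j) \<longrightarrow> d j = 0)"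

text \<open>The candidate for the prefix of \<open>M_word a k\<close> of length
  \<open>digit_sum a d k\<close>, given as a product of powers so that conjugation by it follows the
  recursion of \<open>V_word\<close>.\<close>

primrec T_word :: "(nat \<Rightarrow> nat) \<Rightarrow> (nat \<Rightarrow> nat) \<Rightarrow> nat \<Rightarrow> int list" where
  "T_word a d 0 = []"
| "T_word a d (Suc k) = word_power (M_word a k) (d (Suc k)) @ T_word a d k"

lemma word_power_add: "word_power w (m + n) = word_power w m @ word_power w n"
  by (simp add: replicate_add)

lemma word_power_intertwine:
  assumes "x @ v = w @ x"
  shows "x @ word_power v n = word_power w n @ x"
proof (induction n)
  case (Suc n)
  have "x @ word_power v (Suc n) = (x @ v) @ word_power v n" by simp
  also have "\<dots> = word_power w (Suc n) @ x" using assms Suc by simp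
  finally show ?case .
qed simp

lemma length_word_power: "length (word_power w n) = n * length w"
  by (induction n) auto

lemma nth_word_power:
  "i < n * length w \<Longrightarrow> word_power w n ! i = w ! (i mod length w)"
proof (induction n arbitrary: i)
  case (Suc n)
  show ?case
  proof (cases "i < length w")
    case True
    then show ?thesis by (simp add: nth_append)
  next
    case False
    then show ?thesis using Suc by (simp add: nth_append le_mod_geq)
  qed
qed simp

lemma length_M_word:
  assumes "a 1 \<ge> 1"
  shows "length (M_word a k) = cf_denom a k"
  using assms by (induction a k rule: M_word.induct) (auto simp: length_word_power)

lemma digit_sum_Suc: "digit_sum a d (Suc k) = d (Suc k) * cf_denom a k + digit_sum a d k"
  by (simp add: digit_sum_def)

lemma length_T_word:
  assumes "a 1 \<ge> 1"
  shows "length (T_word a d k) = digit_sum a d k"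
  by (induction k) (simp_all add: length_word_power length_M_word[of a, OF assms] digit_sum_Suc, simp add: digit_sum_def)

text \<open>
  In the free group \<open>V\<^sub>k\<close> is the conjugate of \<open>M\<^sub>k\<close> by \<open>T\<^sub>k\<close>; since \<open>T\<^sub>k\<close> is a power of \<open>M\<^sub>k\<^sub>-\<^sub>1\<close>
  followed by \<open>T\<^sub>k\<^sub>-\<^sub>1\<close>, conjugating \<open>M\<^sub>k\<^sub>-\<^sub>1\<close> by \<open>T\<^sub>k\<close> also gives \<open>V\<^sub>k\<^sub>-\<^sub>1\<close>.
\<close>

lemma T_V_conjugate:
  assumes "admissible_digits a d"
  shows "T_word a d k @ V_word a d k = M_word a k @ T_word a d k"
  using assms
proof (induction a d k rule: V_word.induct)
  case (1 a d)
  then show ?case by simp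
next
  case (2 a d)
  have "d 1 \<le> a 1 - 1" using 2 by (simp add: admissible_digits_def)
  then have "replicate (d 1) (0::int) @ replicate (a 1 - d 1 - 1) 0 = replicate (a 1 - 1) 0"
    by (simp flip: replicate_add)
  moreover have "word_power [0::int] n = replicate n 0" for n by (induction n) auto
  ultimately show ?case by simp
next
  case (3 a d k)
  let ?M = "M_word a" and ?V = "V_word a d" and ?T = "T_word a d"
  let ?b = "d (Suc (Suc k))" and ?a = "a (Suc (Suc k))"
  have le: "?b \<le> ?a" using "3.prems" by (simp add: admissible_digits_def)
  have IH1: "?T (Suc k) @ ?V (Suc k) = ?M (Suc k) @ ?T (Suc k)" using 3 by simp
  have IH0: "?T k @ ?V k = ?M k @ ?T k" using 3 by simp
  have comm: "word_power (?M k) n @ ?M k = ?M k @ word_power (?M k) n" for n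
    by (rule word_power_intertwine[symmetric]) simp
  have cross: "?T (Suc k) @ ?V k = ?M k @ ?T (Suc k)"
    using IH0 comm[of "d (Suc k)"] by (metis T_word.simps(2) append.assoc)
  note pow = word_power_intertwine[OF IH1]
  have "?T (Suc (Suc k)) @ ?V (Suc (Suc k)) =
    word_power (?M (Suc k)) ?b @ (?T (Suc k) @ word_power (?V (Suc k)) (?a - ?b)) @ ?V k
      @ word_power (?V (Suc k)) ?b" by simp
  also have "\<dots> = (word_power (?M (Suc k)) ?b @ word_power (?M (Suc k)) (?a - ?b)) @ (?T (Suc k) @ ?V k)
      @ word_power (?V (Suc k)) ?b" unfolding pow by simp
  also have "\<dots> = word_power (?M (Suc k)) ?a @ ?M k @ ?T (Suc k) @ word_power (?V (Suc k)) ?b"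
    unfolding cross word_power_add[symmetric] using le by simp
  also have "\<dots> = ?M (Suc (Suc k)) @ ?T (Suc (Suc k))" unfolding pow by simp
  finally show ?case .
qed

text \<open>If the top digit is not full, a further copy of \<open>M_word a (Suc k)\<close> remains,
  and it contains \<open>T_word a d (Suc k)\<close> as a prefix. If it is full, only the tail
  \<open>M_word a k\<close> remains; but then the preceding digit is 0, so
  \<open>T_word a d (Suc k)\<close> collapses to \<open>T_word a d k\<close>.\<close>

lemma prefix_T_M:
  assumes "admissible_digits a d"
  shows "prefix (T_word a d k) (M_word a k)"
  using assms
proof (induction a k rule: M_word.induct)
  case (1 a)
  then show ?case by simp
next
  case (2 a)
  have "d 1 \<le> a 1 - 1" using 2 by (simp add: admissible_digits_def)
  then have "replicate (a 1 - 1) (0::int) = replicate (d 1) 0 @ replicate (a 1 - 1 - d 1) 0"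
    by (simp flip: replicate_add)
  moreover have "word_power [0::int] n = replicate n 0" for n by (induction n) auto
  ultimately show ?case by (simp add: prefix_def)
next
  case (3 a k)
  let ?b = "d (Suc (Suc k))" and ?a = "a (Suc (Suc k))" and ?M = "M_word a"
  show ?case
  proof (cases "?b = ?a")
    case True
    then have "d (Suc k) = 0" using "3.prems" by (simp add: admissible_digits_def)
    then show ?thesis using True 3 by simp
  next
    case False
    then have "?b < ?a" using "3.prems" by (simp add: admissible_digits_def order_le_neq_trans)
    then obtain n where "?a = ?b + Suc n" using less_iff_Suc_add by auto
    then have "?M (Suc (Suc k)) = word_power (?M (Suc k)) ?b @ ?M (Suc k) @ word_power (?M (Suc k)) n @ ?M k"
      using word_power_add[of ?b "Suc n" "?M (Suc k)"] by simp
    moreover have "prefix (T_word a d (Suc k)) (?M (Suc k) @ word_power (?M (Suc k)) n @ ?M k)"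
      using 3 by (intro prefix_prefix) simp
    ultimately show ?thesis by simp
  qed
qed

lemma V_word_rotation:
  assumes "admissible_digits a d" "a 1 \<ge> 1"
  obtains R where "M_word a k = T_word a d k @ R" "V_word a d k = R @ T_word a d k"
    "length R + digit_sum a d k = cf_denom a k"
proof -
  obtain R where R: "M_word a k = T_word a d k @ R"
    using prefix_T_M[OF assms(1)] by (auto simp: prefix_def)
  moreover have "V_word a d k = R @ T_word a d k"
    using T_V_conjugate[OF assms(1), of k] R by simp
  moreover have "length R + digit_sum a d k = cf_denom a k"
    using arg_cong[OF R, of length] assms by (simp add: length_M_word length_T_word)
  ultimately show ?thesis using that by blast
qed

section \<open>Convergents and the coding of the rotation\<close>

text \<open>The convergent numerators; the first one is 0 because the integer part of the slope is
  0.\<close>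

fun cf_numer :: "(nat \<Rightarrow> nat) \<Rightarrow> nat \<Rightarrow> nat" where
  "cf_numer a 0 = 0"
| "cf_numer a (Suc 0) = 1"
| "cf_numer a (Suc (Suc k)) = a (Suc (Suc k)) * cf_numer a (Suc k) + cf_numer a k"

lemma cf_determinant:
  "int (cf_numer a (Suc k)) * int (cf_denom a k) - int (cf_numer a k) * int (cf_denom a (Suc k)) = (-1) ^ k"
proof (induction k)
  case (Suc k)
  then show ?case by (simp add: algebra_simps)
qed simp

locale irrational_slope =
  fixes \<theta> :: real
  assumes pos: "0 < \<theta>" and less_one: "\<theta> < 1" and irrational: "\<theta> \<notin> \<rat>"
begin

abbreviation a where "a \<equiv> cf_coeff \<theta>"
abbreviation q where "q \<equiv> cf_denom a"
abbreviation P where "P \<equiv> cf_numer a"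

definition err :: "nat \<Rightarrow> real" where
  "err k = real (q k) * \<theta> - real (P k)"

lemma a_pos: "k \<ge> 1 \<Longrightarrow> a k \<ge> 1"
  using cf_coeff_pos irrational by blast

lemma q_pos: "q k \<ge> 1"
  by (rule cf_denom_pos) (rule a_pos)

lemma q_mono: "q k \<le> q (Suc k)"
proof (cases k)
  case (Suc n)
  have "1 * q k \<le> a (Suc k) * q k" using a_pos[of "Suc k"] by (intro mult_right_mono) auto
  moreover have "q (Suc k) = a (Suc k) * q k + q n" using Suc by simp
  ultimately show ?thesis by linarith
qed (use a_pos[of 1] in simp)

section \<open>Complete quotients and approximation errors\<close>

lemma frac_complete_pos: "0 < frac (cf_complete \<theta> k)"
proof (rule ccontr)
  assume "\<not> 0 < frac (cf_complete \<theta> k)"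
  then have "frac (cf_complete \<theta> k) = 0" using frac_ge_0[of "cf_complete \<theta> k"] by linarith
  \<comment> \<open>By the convention \<open>1 / 0 = 0\<close>, a vanishing fractional part would
    produce a zero partial quotient.\<close>
  then have "cf_complete \<theta> (Suc k) = 0" by (simp only: cf_complete.simps div_by_0)
  then have "a (Suc k) = 0" by (simp add: cf_coeff_def del: cf_complete.simps)
  then show False using a_pos[of "Suc k"] by simp
qed

lemma frac_complete: "frac (cf_complete \<theta> (Suc k)) = 1 / frac (cf_complete \<theta> k) - real (a (Suc k))"
  using frac_complete_pos[of k] by (simp add: cf_coeff_def frac_def)

lemma err_Suc_Suc: "err (Suc (Suc k)) = real (a (Suc (Suc k))) * err (Suc k) + err k"
  by (simp add: err_def algebra_simps)

text \<open>The errors and the fractional parts obey matching recursions. Since the ratio lies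
  strictly between -1 and 0, the errors alternate in sign and shrink.\<close>

lemma err_Suc: "err (Suc k) = - frac (cf_complete \<theta> (Suc k)) * err k"
proof (induction k)
  case 0
  have "frac \<theta> = \<theta>" using pos less_one by (simp add: frac_eq)
  then show ?case using frac_complete[of 0] pos
    by (simp add: err_def field_simps del: cf_complete.simps(2))
next
  case (Suc k)
  let ?f = "frac (cf_complete \<theta> (Suc k))"
  have "err k = - err (Suc k) / ?f"
    using Suc frac_complete_pos[of "Suc k"] by (simp add: field_simps del: cf_complete.simps(2))
  then show ?case unfolding err_Suc_Suc frac_complete[of "Suc k"] by (simp add: algebra_simps del: cf_complete.simps(2))
qed

lemma err_sign: "if even k then err k > 0 else err k < 0"
proof (induction k)
  case 0
  then show ?case using pos by (simp add: err_def)
next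
  case (Suc k)
  then show ?case unfolding err_Suc[of k] using frac_complete_pos[of "Suc k"]
    by (auto simp: mult_less_0_iff zero_less_mult_iff simp del: cf_complete.simps(2) split: if_splits)
qed

lemma abs_err_less_one: "\<bar>err k\<bar> < 1"
proof (induction k)
  case 0
  then show ?case using pos less_one by (simp add: err_def)
next
  case (Suc k)
  have "\<bar>err (Suc k)\<bar> \<le> 1 * \<bar>err k\<bar>"
    unfolding err_Suc[of k] abs_mult
    using frac_complete_pos[of "Suc k"] frac_lt_1[of "cf_complete \<theta> (Suc k)"] by (intro mult_right_mono) auto
  then show ?case using Suc by linarith
qed

text \<open>Consecutive convergents form a unimodular basis, so \<open>(i, j)\<close> is an integer
  combination of them with coefficients \<open>u\<close> and \<open>v\<close>. The bound on
  \<open>i\<close> forces \<open>u\<close> to be nonzero and \<open>v\<close> not to share its sign;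
  as the errors alternate too, the two contributions cannot cancel.\<close>

lemma best_approximation:
  fixes i j :: int
  assumes "i \<noteq> 0" "\<bar>i\<bar> < int (q (Suc k))"
  shows "\<bar>err k\<bar> \<le> \<bar>of_int i * \<theta> - of_int j\<bar>"
proof -
  \<comment> \<open>Cramer's rule: \<open>s\<close> is the determinant of the two convergents, hence
    its own inverse.\<close>
  define s :: int where "s = (-1) ^ k"
  define u where "u = s * (i * int (P (Suc k)) - j * int (q (Suc k)))"
  define v where "v = s * (j * int (q k) - i * int (P k))"
  have ss: "s * s = 1" unfolding s_def by (simp flip: power_mult_distrib)
  note det = cf_determinant[of a k, folded s_def]
  have "u * int (q k) + v * int (q (Suc k)) =
      s * i * (int (P (Suc k)) * int (q k) - int (P k) * int (q (Suc k)))"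
    unfolding u_def v_def by (simp add: algebra_simps)
  then have i: "i = u * int (q k) + v * int (q (Suc k))"
    using det ss by (simp add: mult.assoc mult.left_commute)
  have "u * int (P k) + v * int (P (Suc k)) =
      s * j * (int (P (Suc k)) * int (q k) - int (P k) * int (q (Suc k)))"
    unfolding u_def v_def by (simp add: algebra_simps)
  then have j: "j = u * int (P k) + v * int (P (Suc k))"
    using det ss by (simp add: mult.assoc mult.left_commute)
  have eq: "of_int i * \<theta> - of_int j = of_int u * err k + of_int v * err (Suc k)"
    unfolding i j err_def by (simp add: algebra_simps)
  have qpos: "int (q k) \<ge> 1" "int (q (Suc k)) \<ge> 1" using q_pos[of k] q_pos[of "Suc k"] by linarith+
  have u0: "u \<noteq> 0"
  proof
    assume "u = 0"
    then have "\<bar>v\<bar> * int (q (Suc k)) < 1 * int (q (Suc k))"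
      using assms(2) i by (simp add: abs_mult)
    then have "\<bar>v\<bar> < 1" using qpos by (simp only: mult_less_cancel_right)
    then show False using i \<open>u = 0\<close> assms(1) by simp
  qed
  have opp: "u > 0 \<and> v \<le> 0 \<or> u < 0 \<and> v \<ge> 0"
  proof (rule ccontr)
    assume "\<not> ?thesis"
    then consider "u \<ge> 1" "v \<ge> 1" | "u \<le> -1" "v \<le> -1" using u0 by linarith
    then show False
    proof cases
      case 1
      then have "1 * int (q (Suc k)) \<le> v * int (q (Suc k))" "0 \<le> u * int (q k)"
        using qpos by (auto intro!: mult_right_mono)
      then show False using i assms(2) by linarith
    next
      case 2
      then have "v * int (q (Suc k)) \<le> -1 * int (q (Suc k))" by (intro mult_right_mono) auto
      moreover have "u * int (q k) \<le> 0" using 2 by (intro mult_nonpos_nonneg) auto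
      ultimately show False using i assms(2) by linarith
    qed
  qed
  have signs: "err k > 0 \<and> err (Suc k) < 0 \<or> err k < 0 \<and> err (Suc k) > 0"
    using err_sign[of k] err_sign[of "Suc k"] by (auto split: if_splits)
  have "0 \<le> (of_int u * err k) * (of_int v * err (Suc k))"
    using opp signs by (auto simp: zero_le_mult_iff mult_le_0_iff)
  then have "\<bar>of_int u * err k\<bar> \<le> \<bar>of_int u * err k + of_int v * err (Suc k)\<bar>"
    by (auto simp: zero_le_mult_iff)
  moreover have "1 * \<bar>err k\<bar> \<le> \<bar>of_int u\<bar> * \<bar>err k\<bar>"
    using u0 by (intro mult_right_mono) auto
  ultimately show ?thesis using eq by (simp add: abs_mult)
qed

lemma multiple_eq_int_iff:
  fixes i j :: int
  shows "of_int i * \<theta> = of_int j \<longleftrightarrow> i = 0 \<and> j = 0"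
proof
  assume eq: "of_int i * \<theta> = of_int j"
  have "i = 0"
  proof (rule ccontr)
    assume "i \<noteq> 0"
    then have "\<theta> = of_int j / of_int i" using eq by (simp add: field_simps)
    then show False using irrational by simp
  qed
  then show "i = 0 \<and> j = 0" using eq by simp
qed simp

lemma ceiling_multiple:
  fixes i :: int
  assumes "i \<noteq> 0"
  shows "\<lceil>of_int i * \<theta>\<rceil> = \<lfloor>of_int i * \<theta>\<rfloor> + 1"
  using multiple_eq_int_iff[of i "\<lfloor>of_int i * \<theta>\<rfloor>"] assms by (simp add: ceiling_altdef)

text \<open>For nonzero \<open>i\<close> the point is at least \<open>\<bar>err k\<bar>\<close> away
  from every integer, so adding \<open>err k\<close> crosses none. The lower bound on
  \<open>i\<close> keeps \<open>i + int (q k)\<close> nonzero, so the shifted point is not an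
  integer. Floor and ceiling minus 1 differ only at \<open>i = 0\<close>, where the sign of
  \<open>err k\<close> decides.\<close>

lemma floor_shift:
  fixes i :: int
  assumes "- int (q k) < i" "i < int (q (Suc k))"
  shows "\<lfloor>of_int (i + int (q k)) * \<theta>\<rfloor> =
    int (P k) + (if even k then \<lfloor>of_int i * \<theta>\<rfloor> else \<lceil>of_int i * \<theta>\<rceil> - 1)"
proof -
  have split: "of_int (i + int (q k)) * \<theta> = of_int i * \<theta> + err k + real (P k)"
    by (simp add: err_def algebra_simps)
  have approx: "\<bar>err k\<bar> \<le> \<bar>of_int i * \<theta> - of_int j\<bar>" if "i \<noteq> 0" for j
    using best_approximation[of i k j] that assms q_mono[of k] by linarith
  have notint: "of_int i * \<theta> + err k \<noteq> of_int j" for j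
  proof
    assume "of_int i * \<theta> + err k = of_int j"
    then have "of_int (i + int (q k)) * \<theta> = of_int (j + int (P k))" using split by simp
    then show False using multiple_eq_int_iff[of "i + int (q k)" "j + int (P k)"] assms by linarith
  qed
  have "\<lfloor>of_int i * \<theta> + err k\<rfloor> = (if even k then \<lfloor>of_int i * \<theta>\<rfloor> else \<lceil>of_int i * \<theta>\<rceil> - 1)"
  proof (cases "even k")
    case True
    then have e: "err k > 0" using err_sign[of k] by simp
    let ?j = "\<lfloor>of_int i * \<theta>\<rfloor>"
    have "of_int i * \<theta> + err k \<le> of_int (?j + 1)"
    proof (cases "i = 0")
      case True
      then show ?thesis using abs_err_less_one[of k] by simp
    next
      case False
      then show ?thesis using approx[of "?j + 1"] e by linarith
    qed
    then have "of_int i * \<theta> + err k < of_int (?j + 1)" using notint[of "?j + 1"] by linarith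
    moreover have "of_int ?j \<le> of_int i * \<theta> + err k" using e by linarith
    ultimately have "\<lfloor>of_int i * \<theta> + err k\<rfloor> = ?j" by (intro floor_unique) auto
    then show ?thesis using True by simp
  next
    case False
    then have e: "err k < 0" using err_sign[of k] by simp
    let ?j = "\<lceil>of_int i * \<theta>\<rceil>"
    have "of_int (?j - 1) \<le> of_int i * \<theta> + err k"
    proof (cases "i = 0")
      case True
      then show ?thesis using abs_err_less_one[of k] by simp
    next
      case False
      then show ?thesis using approx[of "?j - 1"] e by linarith
    qed
    moreover have "of_int i * \<theta> + err k < of_int ?j" using e by linarith
    ultimately have "\<lfloor>of_int i * \<theta> + err k\<rfloor> = ?j - 1" by (intro floor_unique) auto
    then show ?thesis using False by simp
  qed
  then show ?thesis unfolding split by (simp add: add.commute)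
qed

section \<open>Steps of the orbit and the letters of \<open>M_word\<close>\<close>

definition floor_step :: "int \<Rightarrow> int" where
  "floor_step i = \<lfloor>of_int (i + 1) * \<theta>\<rfloor> - \<lfloor>of_int i * \<theta>\<rfloor>"

definition ceiling_step :: "int \<Rightarrow> int" where
  "ceiling_step i = \<lceil>of_int (i + 1) * \<theta>\<rceil> - \<lceil>of_int i * \<theta>\<rceil>"

lemma ceiling_step_eq: "i \<ge> 1 \<Longrightarrow> ceiling_step i = floor_step i"
  unfolding ceiling_step_def floor_step_def using ceiling_multiple[of i] ceiling_multiple[of "i + 1"] by simp

text \<open>Both endpoints of the step are shifted. The parity matters only for the two steps that
  touch 0, namely \<open>i = -1\<close> and \<open>i = 0\<close>.\<close>

lemma floor_step_shift:
  assumes "- int (q k) < i" "i + 1 < int (q (Suc k))"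
  shows "floor_step (i + int (q k)) = (if even k then floor_step i else ceiling_step i)"
proof -
  have "- int (q k) < i + 1" "i < int (q (Suc k))" using assms by linarith+
  then show ?thesis
    using floor_shift[of k i] floor_shift[of k "i + 1"] assms
    unfolding floor_step_def ceiling_step_def by (simp add: add_ac)
qed

lemma floor_step_periodic:
  assumes "1 \<le> i" "i + 1 < int (q (Suc k))"
  shows "floor_step (i + int (q k)) = floor_step i"
  using floor_step_shift[of k i] ceiling_step_eq assms by simp

text \<open>For positive \<open>n\<close> the bound says that the last of the \<open>n\<close>
  shifts still starts in the range of \<open>floor_step_periodic\<close>.\<close>

lemma floor_step_periods:
  assumes "1 \<le> i" "i + int n * int (q k) + 1 < int (q (Suc k)) + int (q k)"
  shows "floor_step (i + int n * int (q k)) = floor_step i"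
  using assms(2)
proof (induction n)
  case (Suc n)
  have "0 \<le> int n * int (q k)" by simp
  then have "1 \<le> i + int n * int (q k)" using assms(1) by linarith
  then have "floor_step ((i + int n * int (q k)) + int (q k)) = floor_step (i + int n * int (q k))"
    using Suc.prems by (intro floor_step_periodic) (auto simp: algebra_simps)
  then show ?case using Suc by (simp add: algebra_simps)
qed simp

lemma two_le_q: "2 \<le> q (Suc (Suc k))"
proof -
  have "1 * 1 \<le> a (Suc (Suc k)) * q (Suc k)" using a_pos[of "Suc (Suc k)"] q_pos[of "Suc k"] by (intro mult_mono) auto
  moreover have "q (Suc (Suc k)) = a (Suc (Suc k)) * q (Suc k) + q k" by simp
  ultimately show ?thesis using q_pos[of k] by linarith
qed

text \<open>The signs of \<open>err 1\<close> and \<open>err 2\<close> give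
  \<open>a 1 * \<theta> < 1 < (a 1 + 1) * \<theta>\<close>, so the orbit first passes an integer at
  step \<open>a 1\<close>.\<close>

lemma floor_step_initial:
  assumes "i < a 1"
  shows "floor_step (int i + 1) = (if Suc i = a 1 then 1 else 0)"
proof -
  have "err 1 < 0" using err_sign[of 1] by simp
  then have 1: "real (a 1) * \<theta> < 1" by (simp add: err_def)
  have "err 2 = real (a 2) * err 1 + err 0" using err_Suc_Suc[of 0] by (simp add: numeral_2_eq_2)
  moreover have "err 2 > 0" using err_sign[of 2] by simp
  moreover have "real (a 2) * err 1 \<le> 1 * err 1"
    using a_pos[of 2] \<open>err 1 < 0\<close> by (intro mult_right_mono_neg) auto
  ultimately have 2: "real (a 1) * \<theta> + \<theta> > 1" by (simp add: err_def)
  have small: "\<lfloor>of_int (int n) * \<theta>\<rfloor> = 0" if "n \<le> a 1" for n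
  proof -
    have "real n * \<theta> \<le> real (a 1) * \<theta>" using that pos by (intro mult_right_mono) auto
    then have "real n * \<theta> < 1" using 1 by linarith
    then show ?thesis using pos by (simp add: floor_eq_iff)
  qed
  show ?thesis
  proof (cases "Suc i = a 1")
    case True
    have "of_int (int i + 1 + 1) * \<theta> = real (Suc i) * \<theta> + \<theta>" by (simp add: algebra_simps)
    also have "\<dots> = real (a 1) * \<theta> + \<theta>" using True by simp
    finally have "of_int (int i + 1 + 1) * \<theta> = real (a 1) * \<theta> + \<theta>" .
    then have "\<lfloor>of_int (int i + 1 + 1) * \<theta>\<rfloor> = 1"
      using 1 2 less_one by (simp only: floor_eq_iff) simp
    moreover have "int (a 1) = int i + 1" using True by simp
    ultimately show ?thesis using small[of "a 1"] True unfolding floor_step_def by simp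
  next
    case False
    then show ?thesis using small[of "Suc i"] small[of "Suc (Suc i)"] assms
      unfolding floor_step_def by (simp add: add.commute)
  qed
qed

text \<open>Strong induction along the recursion: the leading copies are compared by shifts of
  \<open>q k\<close>, and so is the final shorter word. The index starts at \<open>Suc k\<close>
  because the formula fails for \<open>M_word a 0\<close> when \<open>a 1 = 1\<close>.\<close>

lemma M_word_nth:
  "i < q (Suc k) \<Longrightarrow> M_word a (Suc k) ! i = floor_step (int i + 1)"
proof (induction k arbitrary: i rule: less_induct)
  case (less k)
  show ?case
  proof (cases k)
    case 0
    then show ?thesis using less.prems floor_step_initial[of i] by (auto simp: nth_append)
  next
    case (Suc n)
    let ?A = "a (Suc k)"
    have len: "length (M_word a j) = q j" for j using length_M_word a_pos by simp
    have M: "M_word a (Suc k) = word_power (M_word a k) ?A @ M_word a n" using Suc by simp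
    have q: "q (Suc k) = ?A * q k + q n" using Suc by simp
    show ?thesis
    proof (cases "i < ?A * q k")
      case True
      let ?r = "i mod q k" and ?d = "i div q k"
      have "M_word a (Suc k) ! i = M_word a k ! ?r"
        unfolding M using True by (simp add: nth_append length_word_power len nth_word_power)
      also have "\<dots> = floor_step (int ?r + 1)"
        using less.IH[of n ?r] Suc q_pos[of k] by simp
      also have "\<dots> = floor_step (int ?r + 1 + int ?d * int (q k))"
      proof (rule floor_step_periods[symmetric])
        have "int i = int (?d * q k + ?r)" by (simp only: div_mult_mod_eq)
        then have "int ?r + int ?d * int (q k) = int i" by (simp only: of_nat_add of_nat_mult)
        moreover have "int i + 1 \<le> int (?A * q k)" using True by linarith
        ultimately show "int ?r + 1 + int ?d * int (q k) + 1 < int (q (Suc k)) + int (q k)"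
          using q q_pos[of k] q_pos[of n] by linarith
      qed simp
      also have "int ?r + 1 + int ?d * int (q k) = int (?d * q k + ?r) + 1" by (simp only: of_nat_add of_nat_mult)
      finally show ?thesis by (simp only: div_mult_mod_eq)
    next
      case False
      define r where "r = i - ?A * q k"
      have r: "i = r + ?A * q k" "r < q n" using False less.prems q by (auto simp: r_def)
      have nth: "M_word a (Suc k) ! i = M_word a n ! r"
        unfolding M using False by (simp add: nth_append length_word_power len r_def)
      show ?thesis
      proof (cases n)
        case 0
        \<comment> \<open>The tail is the single letter of \<open>M_word a 0\<close>, outside the
          induction. It sits at index \<open>q 2\<close>, and \<open>q 2\<close> is an even-order
          denominator, so shifting back to 0 keeps the floor.\<close>
        have "floor_step (0 + int (q 2)) = floor_step 0"
          using floor_step_shift[of 2 0] two_le_q[of 1] q_pos[of 2]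
          by (simp add: numeral_2_eq_2 del: cf_denom.simps)
        moreover have "floor_step 0 = 0" using pos less_one by (simp add: floor_step_def floor_eq_iff)
        moreover have "i + 1 = q 2" using r q 0 Suc by (simp add: numeral_2_eq_2)
        ultimately have "floor_step (int (i + 1)) = 0" by simp
        then show ?thesis using nth r(2) 0 by (simp add: add.commute)
      next
        case (Suc j)
        have "floor_step (int r + 1 + int ?A * int (q k)) = floor_step (int r + 1)"
        proof (rule floor_step_periods)
          show "int r + 1 + int ?A * int (q k) + 1 < int (q (Suc k)) + int (q k)"
            using r(2) two_le_q[of j] \<open>k = Suc n\<close> Suc unfolding q by (simp del: cf_denom.simps)
        qed simp
        moreover have "M_word a n ! r = floor_step (int r + 1)"
          using less.IH[of j r] Suc \<open>k = Suc n\<close> r(2) by simp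
        ultimately show ?thesis using nth r(1) by (simp add: algebra_simps)
      qed
    qed
  qed
qed

text \<open>The first \<open>m\<close> letters of \<open>V_word a d k\<close> are the last
  \<open>m\<close> of \<open>M_word a k\<close>, at indices \<open>n - m + q k\<close>. Shifting
  them back to indices at most 0 is where the parity enters; at the later, positive indices the two
  step functions agree.\<close>

lemma V_word_nth:
  assumes d: "admissible_digits a d" and t: "digit_sum a d k + m = q k"
    and "k \<ge> 1" "n \<ge> 1" "n \<le> q k"
  shows "V_word a d k ! (n - 1) = (if even k then floor_step else ceiling_step) (int n - int m)"
proof -
  obtain j where k: "k = Suc j" using assms(3) by (cases k) auto
  obtain R where R: "M_word a k = T_word a d k @ R" "V_word a d k = R @ T_word a d k"
    "length R + digit_sum a d k = q k" using V_word_rotation[OF d, of k] a_pos by auto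
  have lenR: "length R = m" using R(3) t by simp
  have lenT: "length (T_word a d k) = digit_sum a d k" using length_T_word a_pos by simp
  have M: "M_word a k ! i = floor_step (int i + 1)" if "i < q k" for i
    using M_word_nth that k by simp
  show ?thesis
  proof (cases "n \<le> m")
    case True
    have "V_word a d k ! (n - 1) = M_word a k ! (digit_sum a d k + (n - 1))"
      unfolding R(1,2) lenT[symmetric] nth_append_length_plus
      using lenR True assms(4) by (intro nth_append_left) linarith
    also have "\<dots> = floor_step (int (digit_sum a d k + (n - 1)) + 1)"
      using M True t assms(4) by simp
    also have "int (digit_sum a d k + (n - 1)) + 1 = (int n - int m) + int (q k)"
      using t assms(4) by simp
    \<comment> \<open>For \<open>n = m\<close> the right endpoint is 1, so the shift requires
      \<open>q (Suc k) \<ge> 2\<close>; this holds because \<open>k\<close> is positive.\<close>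
    also have "floor_step \<dots> = (if even k then floor_step else ceiling_step) (int n - int m)"
      using floor_step_shift[of k "int n - int m"] t True assms(4) two_le_q[of j] k
      by (simp del: cf_denom.simps)
    finally show ?thesis .
  next
    case False
    have "V_word a d k ! (n - 1) = T_word a d k ! (n - 1 - m)"
      unfolding R(2) lenR[symmetric] using lenR False by (intro nth_append_right) linarith
    also have "\<dots> = M_word a k ! (n - 1 - m)"
      unfolding R(1) using lenT t False assms(5) by (intro nth_append_left[symmetric]) linarith
    also have "\<dots> = floor_step (int (n - 1 - m) + 1)" using M assms(4,5) by simp
    also have "int (n - 1 - m) + 1 = int n - int m" using False by simp
    finally show ?thesis using ceiling_step_eq[of "int n - int m"] False by simp
  qed
qed

lemma length_V_word:
  assumes "admissible_digits a d"
  shows "length (V_word a d k) = q k"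
  using V_word_rotation[OF assms, of k] length_T_word a_pos
  by (metis add.commute length_append length_M_word le_refl)

text \<open>A zero digit followed by a full one raises both \<open>digit_sum\<close> and
  \<open>q\<close> by the same amount, so their difference stays \<open>m\<close> at every second
  index from \<open>k0\<close> on. At the other indices the zero digit makes the preceding word a
  prefix of the current one.\<close>

lemma word_limit_V_word:
  assumes d: "admissible_digits a d" and k0: "k0 \<ge> 1"
    and base: "digit_sum a d k0 + m = q k0"
    and zero: "\<And>j. d (k0 + 2 * j + 1) = 0"
    and full: "\<And>j. d (k0 + 2 * j + 2) = a (k0 + 2 * j + 2)"
  shows "word_limit (V_word a d) (\<lambda>n. (if even k0 then floor_step else ceiling_step) (int n - int m))"
  unfolding word_limit_def
proof (intro allI impI)
  fix n :: nat assume n: "n \<ge> 1"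
  let ?s = "(if even k0 then floor_step else ceiling_step) (int n - int m)"
  have sum: "digit_sum a d (k0 + 2 * j) + m = q (k0 + 2 * j)" for j
  proof (induction j)
    case (Suc j)
    have "digit_sum a d (k0 + 2 * Suc j) = digit_sum a d (Suc (Suc (k0 + 2 * j)))" by simp
    then show ?case using Suc zero[of j] full[of j] by (simp add: digit_sum_Suc)
  qed (simp add: base)
  have large: "n \<le> q k" if "n + 1 \<le> k" for k
    using cf_denom_ge[of a "k - 1"] a_pos that by (cases k) auto
  have main: "V_word a d (k0 + 2 * j) ! (n - 1) = ?s" if "n + 1 \<le> k0 + 2 * j" for j
    using V_word_nth[OF d sum[of j] _ n large[OF that]] k0 by simp
  \<comment> \<open>The threshold leaves room for passing from \<open>k\<close> to
    \<open>k - 1\<close> when \<open>k\<close> has the other parity.\<close>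
  have "n \<le> length (V_word a d k) \<and> V_word a d k ! (n - 1) = ?s" if k: "k \<ge> k0 + n + 2" for k
  proof
    show "n \<le> length (V_word a d k)" using large[of k] k d by (simp add: length_V_word)
    show "V_word a d k ! (n - 1) = ?s"
    proof (cases "even (k - k0)")
      case True
      then obtain j where "k - k0 = 2 * j" by (elim evenE)
      then have "k = k0 + 2 * j" using k by linarith
      then show ?thesis using main[of j] k by simp
    next
      case False
      then obtain j where "k - k0 = 2 * j + 1" by (elim oddE)
      then have kj: "k = Suc (k0 + 2 * j)" using k by linarith
      obtain i where i: "k0 + 2 * j = Suc i" using k0 by (cases "k0 + 2 * j") auto
      have "a (Suc (Suc i)) \<ge> 1" by (rule a_pos) simp
      then obtain c where c: "a (Suc (Suc i)) = Suc c" by (cases "a (Suc (Suc i))") auto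
      have "d (Suc (Suc i)) = 0" using zero[of j] i by simp
      then have "V_word a d k = V_word a d (Suc i) @ word_power (V_word a d (Suc i)) c @ V_word a d i"
        using kj i c by simp
      moreover have "n - 1 < length (V_word a d (Suc i))"
        using large[of "Suc i"] k kj i n by (simp add: length_V_word[OF d] del: cf_denom.simps)
      ultimately have "V_word a d k ! (n - 1) = V_word a d (Suc i) ! (n - 1)"
        by (simp add: nth_append)
      then show ?thesis using main[of j] k kj i by simp
    qed
  qed
  then show "\<forall>\<^sub>F k in sequentially. n \<le> length (V_word a d k) \<and> V_word a d k ! (n - 1) = ?s"
    unfolding eventually_sequentially by blast
qed

section \<open>The digit sequences\<close>

lemma ostrowski_spec:
  assumes "N < q n"
  shows "admissible_digits a (ostrowski a N)" "N = digit_sum a (ostrowski a N) n"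
proof -
  obtain d where d: "d 0 = 0 \<and> d 1 \<le> a 1 - 1 \<and> (\<forall>j\<ge>1. d j \<le> a j) \<and>
     (\<forall>j\<ge>1. d (j + 1) = a (j + 1) \<longrightarrow> d j = 0) \<and>
     (\<forall>j>n. d j = 0) \<and> N = (\<Sum>j=1..n. d j * q (j - 1))"
    using ostrowski_exists[of a N n] a_pos assms by blast
  then have "is_ostrowski a N d" unfolding is_ostrowski_def by blast
  then have "ostrowski a N = d"
    unfolding ostrowski_def using ex1_is_ostrowski[of a N] a_pos by (intro the1_equality) auto
  then show "admissible_digits a (ostrowski a N)" "N = digit_sum a (ostrowski a N) n"
    using d by (auto simp: admissible_digits_def digit_sum_def)
qed

section \<open>Digits in the case of \<open>m\<close> at least 2\<close>

context
  fixes m l :: nat and e :: "nat \<Rightarrow> nat"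
  assumes m: "q l < m" "m \<le> q (l + 1)" and e_def: "e = ostrowski a (q (l + 1) - m)"
begin

lemma m_ge_2: "m \<ge> 2"
  using m q_pos[of l] by linarith

lemma e_admissible: "admissible_digits a e" and e_sum: "digit_sum a e (l + 1) + m = q (l + 1)"
proof -
  have "q (l + 1) - m < q (l + 1)" using m by linarith
  note s = ostrowski_spec[OF this, folded e_def]
  show "admissible_digits a e" by (rule s)
  show "digit_sum a e (l + 1) + m = q (l + 1)" using s(2) m by linarith
qed

lemma e_bounds: "e 1 \<le> a 1 - 1" "j \<ge> 1 \<Longrightarrow> e j \<le> a j"
    "j \<ge> 1 \<Longrightarrow> e (Suc j) = a (Suc j) \<Longrightarrow> e j = 0"
  using e_admissible unfolding admissible_digits_def by blast+

lemma top_digit: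
  shows "e (l + 1) < a (l + 1)" and "l = 0 \<Longrightarrow> e 1 + 1 < a 1"
    and "l \<ge> 1 \<Longrightarrow> e (l + 1) + 1 = a (l + 1) \<Longrightarrow> e l = 0"
proof -
  \<comment> \<open>Since \<open>m > q l\<close>, the expansion leaves room for one more
    \<open>q l\<close>; this is what allows the digit \<open>l + 1\<close> to be raised in
    \<open>digits'\<close>.\<close>
  have lt: "(e (l + 1) + 1) * q l + digit_sum a e l < q (l + 1)"
    using e_sum m(1) by (simp add: digit_sum_Suc)
  show 0: "e 1 + 1 < a 1" if "l = 0" using lt that by simp
  have *: "e (l + 1) < a (l + 1) \<and> (e (l + 1) + 1 = a (l + 1) \<longrightarrow> e l = 0)" if "l = Suc j" for j
  proof -
    have q: "q (l + 1) = a (l + 1) * q l + q j" using that by simp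
    have "(e (l + 1) + 1) * q l < (a (l + 1) + 1) * q l"
      using lt q q_mono[of j, folded that] unfolding add_mult_distrib by linarith
    then have "e (l + 1) < a (l + 1)" using mult_less_cancel2[of "e (l + 1) + 1" "q l" "a (l + 1) + 1"] by linarith
    moreover have "e l = 0" if "e (l + 1) + 1 = a (l + 1)"
    proof -
      \<comment> \<open>If the raised digit is full, what remains is below the weight
        \<open>q j\<close> of the digit \<open>e l\<close>.\<close>
      have "digit_sum a e l < q j" using lt q unfolding that by linarith
      then show ?thesis using \<open>l = Suc j\<close> by (cases "e l") (auto simp: digit_sum_Suc)
    qed
    ultimately show ?thesis by blast
  qed
  then show "e (l + 1) < a (l + 1)" using 0 by (cases l) auto
  show "l \<ge> 1 \<Longrightarrow> e (l + 1) + 1 = a (l + 1) \<Longrightarrow> e l = 0" using * by (cases l) auto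
qed

lemma digits_eq:
  "digits a m l i = (if i \<le> l + 1 then e i else if even (i - l) then 0 else a i)"
  using m_ge_2 by (simp add: digits_def e_def)

lemma digits'_eq:
  "digits' a m l i = (if i \<le> l then e i else if i = l + 1 then e i + 1
     else if i = l + 2 then a i - 1 else if even (i - l) then a i else 0)"
  using m_ge_2 by (simp add: digits'_def digits_eq)

lemma digits_admissible: "admissible_digits a (digits a m l)"
  unfolding admissible_digits_def
proof (intro conjI allI impI)
  show "digits a m l 1 \<le> a 1 - 1" using e_bounds(1) by (simp add: digits_eq)
  fix j :: nat assume j: "1 \<le> j"
  show "digits a m l j \<le> a j" using e_bounds(2)[OF j] by (simp add: digits_eq)
  assume eq: "digits a m l (Suc j) = a (Suc j)"
  consider "j \<le> l" | "j = l + 1" | "j > l + 1" by linarith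
  then show "digits a m l j = 0"
  proof cases
    case 1
    then show ?thesis using eq e_bounds(3)[OF j] by (simp add: digits_eq)
  next
    case 2
    then show ?thesis using eq a_pos[of "Suc j"] by (simp add: digits_eq)
  next
    case 3
    then have "even (Suc j - l) \<longleftrightarrow> odd (j - l)" by (simp add: Suc_diff_le)
    then show ?thesis using 3 eq a_pos[of "Suc j"] by (simp add: digits_eq split: if_splits)
  qed
qed

text \<open>At the junction \<open>top_digit\<close> permits the raised digit \<open>l + 1\<close>.
  The next digit is one short of full and the one after it is 0, so neither constrains its
  predecessor.\<close>

lemma digits'_admissible: "admissible_digits a (digits' a m l)"
  unfolding admissible_digits_def
proof (intro conjI allI impI)
  show "digits' a m l 1 \<le> a 1 - 1"
    using e_bounds(1) top_digit(2) by (auto simp: digits'_eq)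
  fix j :: nat assume j: "1 \<le> j"
  show "digits' a m l j \<le> a j"
    using e_bounds(2)[OF j] top_digit(1) by (auto simp: digits'_eq)
  assume eq: "digits' a m l (Suc j) = a (Suc j)"
  consider "j < l" | "j = l" | "j = l + 1" | "j = l + 2" | "j > l + 2" by linarith
  then show "digits' a m l j = 0"
  proof cases
    case 1
    then show ?thesis using eq e_bounds(3)[OF j] by (simp add: digits'_eq)
  next
    case 2
    then show ?thesis using eq top_digit(3) j by (simp add: digits'_eq)
  next
    case 3
    then show ?thesis using eq a_pos[of "Suc j"] by (simp add: digits'_eq)
  next
    case 4
    then show ?thesis using eq a_pos[of "Suc j"] by (simp add: digits'_eq)
  next
    case 5
    then have "even (Suc j - l) \<longleftrightarrow> odd (j - l)" by (simp add: Suc_diff_le)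
    then show ?thesis using 5 eq a_pos[of "Suc j"] by (simp add: digits'_eq split: if_splits)
  qed
qed

text \<open>The base index is \<open>l + 1\<close>, so the parity is opposite to that of
  \<open>l\<close>.\<close>

lemma word_limit_digits:
  "word_limit (V_word a (digits a m l)) (\<lambda>n. (if odd l then floor_step else ceiling_step) (int n - int m))"
proof -
  have "digit_sum a (digits a m l) (l + 1) = digit_sum a e (l + 1)"
    unfolding digit_sum_def by (rule sum.cong) (auto simp: digits_eq)
  then have "digit_sum a (digits a m l) (l + 1) + m = q (l + 1)" using e_sum by simp
  from word_limit_V_word[OF digits_admissible _ this] show ?thesis
    by (simp add: digits_eq del: cf_denom.simps V_word.simps)
qed

text \<open>Raising digit \<open>l + 1\<close> overshoots \<open>q (l + 1) - m\<close> by
  \<open>q l\<close>. The next digit \<open>a (l + 2) - 1\<close> turns this into exactly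
  \<open>q (l + 2) - m\<close>, so the base index is \<open>l + 2\<close>.\<close>

lemma word_limit_digits':
  "word_limit (V_word a (digits' a m l)) (\<lambda>n. (if even l then floor_step else ceiling_step) (int n - int m))"
proof -
  have "digit_sum a (digits' a m l) l = digit_sum a e l"
    unfolding digit_sum_def by (rule sum.cong) (auto simp: digits'_eq)
  then have "digit_sum a (digits' a m l) (l + 1) + m = q (l + 1) + q l"
    using e_sum by (simp add: digit_sum_Suc digits'_eq)
  moreover have "(a (Suc (Suc l)) - 1) * q (Suc l) + q (Suc l) = a (Suc (Suc l)) * q (Suc l)"
    using a_pos[of "Suc (Suc l)"] by (cases "a (Suc (Suc l))") auto
  ultimately have "digit_sum a (digits' a m l) (l + 2) + m = q (l + 2)"
    by (simp add: digit_sum_Suc[of _ _ "Suc l"] digits'_eq)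
  from word_limit_V_word[OF digits'_admissible _ this] show ?thesis
    by (simp add: digits'_eq del: cf_denom.simps V_word.simps)
qed

end

section \<open>Digits in the case \<open>m = 1\<close>\<close>

lemma digits_1_admissible:
  "admissible_digits a (digits a 1 l)" "admissible_digits a (digits' a 1 l)"
proof -
  have nz: "a (Suc j) \<noteq> 0" for j using a_pos[of "Suc j"] by simp
  show "admissible_digits a (digits a 1 l)" "admissible_digits a (digits' a 1 l)"
    by (auto simp: admissible_digits_def digits_def digits'_def nz)
qed

text \<open>The base indices are 1 and 2, since \<open>a 1 - 1 = q 1 - 1\<close> and
  \<open>a 2 * q 1 = q 2 - 1\<close>.\<close>

lemma word_limit_digits_1:
  "word_limit (V_word a (digits a 1 0)) (\<lambda>n. ceiling_step (int n - 1))"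
  "word_limit (V_word a (digits' a 1 0)) (\<lambda>n. floor_step (int n - 1))"
proof -
  have "digit_sum a (digits a 1 0) 1 + 1 = q 1" using a_pos[of 1] by (simp add: digit_sum_def digits_def)
  from word_limit_V_word[OF digits_1_admissible(1) _ this]
  show "word_limit (V_word a (digits a 1 0)) (\<lambda>n. ceiling_step (int n - 1))" by (simp add: digits_def)
  have "digit_sum a (digits' a 1 0) 2 + 1 = q 2"
    by (simp add: digit_sum_def digits'_def numeral_2_eq_2)
  from word_limit_V_word[OF digits_1_admissible(2) _ this]
  show "word_limit (V_word a (digits' a 1 0)) (\<lambda>n. floor_step (int n - 1))" by (simp add: digits'_def)
qed

section \<open>The infinite words as codings, and the final statement\<close>

lemma lower_word_eq_floor_step:
  assumes "\<rho> - \<theta> = - real m * \<theta> + real_of_int p"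
  shows "lower_word \<theta> \<rho> = (\<lambda>n. floor_step (int n - int m))"
proof
  fix n
  have 1: "real n * \<theta> + \<rho> = of_int (int n - int m + 1) * \<theta> + of_int p"
    and 2: "(real n - 1) * \<theta> + \<rho> = of_int (int n - int m) * \<theta> + of_int p"
    using assms by (simp_all add: algebra_simps)
  show "lower_word \<theta> \<rho> n = floor_step (int n - int m)"
    unfolding lower_word_def floor_step_def 1 2 by simp
qed

lemma upper_word_eq_ceiling_step:
  assumes "\<rho> - \<theta> = - real m * \<theta> + real_of_int p"
  shows "upper_word \<theta> \<rho> = (\<lambda>n. ceiling_step (int n - int m))"
proof
  fix n
  have 1: "real n * \<theta> + \<rho> = of_int (int n - int m + 1) * \<theta> + of_int p"
    and 2: "(real n - 1) * \<theta> + \<rho> = of_int (int n - int m) * \<theta> + of_int p"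
    using assms by (simp_all add: algebra_simps)
  show "upper_word \<theta> \<rho> n = ceiling_step (int n - int m)"
    unfolding upper_word_def ceiling_step_def 1 2 by simp
qed

text \<open>The length of \<open>R\<close> is an integer difference, so truncated subtraction cannot
  hide a \<open>digit_sum\<close> exceeding \<open>q k\<close>.\<close>

lemma V_word_rotation_of_M_word:
  assumes "admissible_digits a d"
  shows "\<exists>T R. prefix T (M_word a k) \<and> length T = digit_sum a d k \<and>
        suffix R (M_word a k) \<and> int (length R) = int (q k) - int (digit_sum a d k) \<and>
        V_word a d k = R @ T \<and> M_word a k = T @ R"
proof -
  have a1: "a 1 \<ge> 1" by (rule a_pos) simp
  obtain R where R: "M_word a k = T_word a d k @ R" "V_word a d k = R @ T_word a d k"
    "length R + digit_sum a d k = q k" by (rule V_word_rotation[OF assms a1])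
  show ?thesis
    by (rule exI[of _ "T_word a d k"], rule exI[of _ R])
      (use R length_T_word[of a d k, OF a1] in \<open>auto simp: prefix_def suffix_def\<close>)
qed

end

theorem theorem4p2:
  fixes \<theta> \<rho> :: real and m l :: nat and p :: int
    and a q \<beta> \<beta>' t t' :: "nat \<Rightarrow> nat" and M V V' :: "nat \<Rightarrow> int list"
  defines "a \<equiv> cf_coeff \<theta>"
  defines "q \<equiv> cf_denom a"
  defines "M \<equiv> M_word a"
  defines "\<beta> \<equiv> digits a m l"
  defines "\<beta>' \<equiv> digits' a m l"
  defines "V \<equiv> V_word a \<beta>"
  defines "V' \<equiv> V_word a \<beta>'"
  defines "t \<equiv> digit_sum a \<beta>"
  defines "t' \<equiv> digit_sum a \<beta>'"
  assumes "0 < \<theta>" and "\<theta> < 1" and "\<theta> \<notin> \<rat>"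
    and "0 \<le> \<rho>" and "\<rho> < 1"
    and "m \<ge> 1" and "\<rho> - \<theta> = - real m * \<theta> + real_of_int p"
    and "m \<ge> 2 \<Longrightarrow> q l < m \<and> m \<le> q (l + 1)"
    and "m = 1 \<Longrightarrow> l = 0"
  shows "(odd l \<longrightarrow> word_limit V (lower_word \<theta> \<rho>) \<and> word_limit V' (upper_word \<theta> \<rho>)) \<and>
    (even l \<longrightarrow> word_limit V' (lower_word \<theta> \<rho>) \<and> word_limit V (upper_word \<theta> \<rho>)) \<and>
    (\<forall>k\<ge>1. \<exists>T R. prefix T (M k) \<and> length T = t k \<and>
        suffix R (M k) \<and> int (length R) = int (q k) - int (t k) \<and>
        V k = R @ T \<and> M k = T @ R) \<and>
    (\<forall>k\<ge>1. \<exists>T' R'. prefix T' (M k) \<and> length T' = t' k \<and>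
        suffix R' (M k) \<and> int (length R') = int (q k) - int (t' k) \<and>
        V' k = R' @ T' \<and> M k = T' @ R')"
proof -
  interpret irrational_slope \<theta> by unfold_locales fact+
  note defs = a_def q_def M_def \<beta>_def \<beta>'_def V_def V'_def t_def t'_def
  note \<rho> = \<open>\<rho> - \<theta> = - real m * \<theta> + real_of_int p\<close>
  let ?a = "cf_coeff \<theta>"
  let ?\<beta> = "digits ?a m l" and ?\<beta>' = "digits' ?a m l"
  \<comment> \<open>For \<open>m = 1\<close> the convention \<open>l = 0\<close> is even, so one
    parity formula covers both cases.\<close>
  have main: "admissible_digits ?a ?\<beta> \<and> admissible_digits ?a ?\<beta>' \<and>
    word_limit (V_word ?a ?\<beta>) (\<lambda>n. (if odd l then floor_step else ceiling_step) (int n - int m)) \<and>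
    word_limit (V_word ?a ?\<beta>') (\<lambda>n. (if even l then floor_step else ceiling_step) (int n - int m))"
  proof (cases "m = 1")
    case True
    with \<open>m = 1 \<Longrightarrow> l = 0\<close> have "l = 0" by blast
    with True show ?thesis using digits_1_admissible[of 0] word_limit_digits_1 by simp
  next
    case False
    with \<open>m \<ge> 1\<close> have "m \<ge> 2" by linarith
    with \<open>m \<ge> 2 \<Longrightarrow> q l < m \<and> m \<le> q (l + 1)\<close>
    have m: "cf_denom ?a l < m" "m \<le> cf_denom ?a (l + 1)" unfolding defs by blast+
    from digits_admissible[OF m refl] digits'_admissible[OF m refl]
      word_limit_digits[OF m refl] word_limit_digits'[OF m refl]
    show ?thesis by (intro conjI)
  qed
  show ?thesis
    unfolding defs lower_word_eq_floor_step[OF \<rho>] upper_word_eq_ceiling_step[OF \<rho>]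
  proof (intro conjI impI allI)
    fix k
    show "\<exists>T R. prefix T (M_word ?a k) \<and> length T = digit_sum ?a ?\<beta> k \<and> suffix R (M_word ?a k) \<and>
        int (length R) = int (cf_denom ?a k) - int (digit_sum ?a ?\<beta> k) \<and>
        V_word ?a ?\<beta> k = R @ T \<and> M_word ?a k = T @ R"
      using main by (intro V_word_rotation_of_M_word) (rule conjunct1)
    show "\<exists>T R. prefix T (M_word ?a k) \<and> length T = digit_sum ?a ?\<beta>' k \<and> suffix R (M_word ?a k) \<and>
        int (length R) = int (cf_denom ?a k) - int (digit_sum ?a ?\<beta>' k) \<and>
        V_word ?a ?\<beta>' k = R @ T \<and> M_word ?a k = T @ R"
      using main by (intro V_word_rotation_of_M_word) blast
  qed (use main in simp_all)
qed

end
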